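(* Let $m \ge 2$ be an even integer, let $n \ge 1$, and let $\mathcal{A} = (a_{i_1\cdots i_m})$ be a real $m$th order $n$-dimensional tensor that is a P-tensor. Then $$\alpha(T_{\mathcal{A}}) \le \delta_Z(\mathcal{A}) \le \min_{i\in I_n} a_{ii\cdots i}.$$
   Context: Let $I_n = \{1,\dots,n\}$. A real $m$th order $n$-dimensional tensor $\mathcal{A} = (a_{i_1\cdots i_m})$ is a multi-array of real entries $a_{i_1\cdots i_m}$, with $i_j \in I_n$ for $j = 1,\dots,m$ (no symmetry is assumed). For a vector $x \in \mathbb{R}^n$, $\mathcal{A}x^{m-1} \in \mathbb{R}^n$ is the vector with $i$th component $$(\mathcal{A}x^{m-1})_i = \sum_{i_2,\dots,i_m=1}^n a_{i i_2\cdots i_m} x_{i_2}\cdots x_{i_m}, \quad i \in I_n.$$ P-tensor: $\mathcal{A}$ is a P-tensor iff for every nonzero $x \in \mathbb{R}^n$, $\max_{i \in I_n} x_i (\mathcal{A}x^{m-1})_i > 0$. Z-eigenvalue: a real number $\lambda$ is a Z-eigenvalue of $\mathcal{A}$ iff there is $x \in \mathbb{R}^n$ with $x^\top x = 1$ and $\mathcal{A}x^{m-1} = \lambda x$. Principal sub-tensor: for a nonempty $J \subset I_n$ with $|J| = r$ ($1 \le r \le n$), $\mathcal{A}_r^J$ is the $m$th order $r$-dimensional tensor $(a_{i_1\cdots i_m})$ with $i_1,\dots,i_m \in J$. The quantity $\delta_Z$: for $m$ even and $\mathcal{A}$ a P-tensor, let $\lambda_Z(\mathcal{A}_r^J)$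 denote the smallest Z-eigenvalue of $\mathcal{A}_r^J$ (if any exists), and $$\delta_Z(\mathcal{A}) := \min\{\lambda_Z(\mathcal{A}_r^J) : J \subset I_n,\ |J| = r,\ r \in I_n\},$$ where the minimum ranges over those principal sub-tensors of $\mathcal{A}$ that have Z-eigenvalues. (For $m$ even and $\mathcal{A}$ a P-tensor this is well defined, finite and positive.) The quantity $\alpha(T_{\mathcal{A}})$: $T_{\mathcal{A}} : \mathbb{R}^n \to \mathbb{R}^n$ is defined by $T_{\mathcal{A}}(x) := \|x\|_2^{2-m}\mathcal{A}x^{m-1}$ for $x \ne 0$ and $T_{\mathcal{A}}(0) := 0$, and $$\alpha(T_{\mathcal{A}}) := \min_{\|x\|_\infty = 1}\ \max_{i \in I_n} x_i (T_{\mathcal{A}}(x))_i,$$ where $x$ ranges over $\mathbb{R}^n$, $\|x\|_\infty = \max_{i \in I_n}|x_i|$ and $\|x\|_2 = \left(\sum_{i=1}^n |x_i|^2\right)^{1/2}$. *)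

theory Defs
  imports "HOL-Analysis.Analysis"
begin

text \<open>
  A real tensor of order \<open>m\<close> on a finite index set \<open>I\<close> is a function on index lists; only its values
  on lists of length \<open>m\<close> with entries in \<open>I\<close> are read.  Likewise a vector of \<open>\<real>\<^sup>I\<close> is a function of
  which only the values on \<open>I\<close> are read.  The order and the index set are explicit arguments
  throughout, so the principal sub-tensor on \<open>J \<subseteq> I\<close> is the same array taken with index set \<open>J\<close>.
\<close>

type_synonym 'i tensor = "'i list \<Rightarrow> real"

definition tensor_apply :: "nat \<Rightarrow> 'i set \<Rightarrow> 'i tensor \<Rightarrow> ('i \<Rightarrow> real) \<Rightarrow> 'i \<Rightarrow> real" where
  "tensor_apply m I A x i =
     (\<Sum>js | set js \<subseteq> I \<and> length js = m - 1. A (i # js) * prod_list (map x js))"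

definition P_tensor :: "nat \<Rightarrow> 'i set \<Rightarrow> 'i tensor \<Rightarrow> bool" where
  "P_tensor m I A \<longleftrightarrow>
     (\<forall>x. (\<exists>i\<in>I. x i \<noteq> 0) \<longrightarrow> Max ((\<lambda>i. x i * tensor_apply m I A x i) ` I) > 0)"

definition Z_eigenvalue :: "nat \<Rightarrow> 'i set \<Rightarrow> 'i tensor \<Rightarrow> real \<Rightarrow> bool" where
  "Z_eigenvalue m I A \<mu> \<longleftrightarrow>
     (\<exists>x. (\<Sum>i\<in>I. x i * x i) = 1 \<and> (\<forall>i\<in>I. tensor_apply m I A x i = \<mu> * x i))"

text \<open>
  Minima over possibly infinite sets of reals are rendered by \<open>LEAST\<close>, the attained minimum.  For
  finite nonempty \<open>I\<close> it exists in both uses below as soon as the set is nonempty: the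
  Z-eigenvalues form a compact set, and \<open>alpha_T\<close> minimizes a continuous function over a compact
  sphere.
\<close>

definition least_Z_eigenvalue :: "nat \<Rightarrow> 'i set \<Rightarrow> 'i tensor \<Rightarrow> real" where
  "least_Z_eigenvalue m I A = (LEAST \<mu>. Z_eigenvalue m I A \<mu>)"

definition delta_Z :: "nat \<Rightarrow> 'i set \<Rightarrow> 'i tensor \<Rightarrow> real" where
  "delta_Z m I A =
     Min {least_Z_eigenvalue m J A | J. J \<subseteq> I \<and> J \<noteq> {} \<and> (\<exists>\<mu>. Z_eigenvalue m J A \<mu>)}"

definition T_map :: "nat \<Rightarrow> 'i set \<Rightarrow> 'i tensor \<Rightarrow> ('i \<Rightarrow> real) \<Rightarrow> 'i \<Rightarrow> real" where
  "T_map m I A x i =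
     (if \<forall>j\<in>I. x j = 0 then 0
      else L2_set x I powi (2 - int m) * tensor_apply m I A x i)"

definition sup_norm_on :: "'i set \<Rightarrow> ('i \<Rightarrow> real) \<Rightarrow> real" where
  "sup_norm_on I x = Max ((\<lambda>i. \<bar>x i\<bar>) ` I)"

definition alpha_T :: "nat \<Rightarrow> 'i set \<Rightarrow> 'i tensor \<Rightarrow> real" where
  "alpha_T m I A =
     (LEAST v. \<exists>x. sup_norm_on I x = 1 \<and> v = Max ((\<lambda>i. x i * T_map m I A x i) ` I))"

end

theory Submission
  imports Defs
begin

text \<open>
  A Z-eigenvector of a principal sub-tensor on \<open>J\<close>, extended by zero, is a test vector for
  \<open>alpha_T\<close>.  Let \<open>x\<close> be the unit Z-eigenvector on \<open>J\<close> for \<open>\<mu>\<close> and \<open>y\<close> its extension.  Entries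
  outside \<open>J\<close> contribute nothing to the tensor sums, so \<open>y\<^sub>i (A y\<^bsup>m-1\<^esup>)\<^sub>i\<close> is \<open>\<mu> y\<^sub>i\<^sup>2\<close> on \<open>J\<close>, and
  it is \<open>0\<close> off \<open>J\<close> because there \<open>y\<^sub>i = 0\<close>; hence it is \<open>\<mu> y\<^sub>i\<^sup>2\<close> for every \<open>i\<close>
  (\<open>zero_extension_product\<close>).  The P-property forces \<open>\<mu> > 0\<close>.  Since
  \<open>T_map\<close> is positively homogeneous of degree one, dividing \<open>y\<close> by its sup norm \<open>s\<close> turns these
  products into \<open>\<mu> (y\<^sub>i / s)\<^sup>2\<close>, whose maximum over \<open>i\<close> is exactly \<open>\<mu>\<close>.  So every Z-eigenvalue of
  every principal sub-tensor is one of the values minimized by \<open>alpha_T\<close>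
  (\<open>Z_eigenvalue_is_minimax_value\<close>), which gives the first inequality.

  For the second, an order-\<open>m\<close> tensor of dimension one with \<open>m\<close> even has its single entry as its
  only Z-eigenvalue, since \<open>t\<^bsup>m-1\<^esup> = t\<close> for \<open>t = 1\<close> and \<open>t = - 1\<close>; so each diagonal entry is one of
  the numbers in the minimum that defines \<open>delta_Z\<close>.

  The minima are given by \<open>LEAST\<close>, so it has to be shown that they are attained.  Both are minima of
  a continuous function on a compact set of vectors: the sup-norm sphere for \<open>alpha_T\<close>, and for the
  Z-eigenvalues the set of unit Z-eigenvectors, on which the eigenvalue is the continuous function
  \<open>\<Sum>\<^sub>i x\<^sub>i (A x\<^bsup>m-1\<^esup>)\<^sub>i\<close>.
\<close>

section \<open>Attained minima over vectors with finite support\<close>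

lemma Least_image_attained:
  fixes g :: "'a::topological_space \<Rightarrow> real"
  assumes "compact K" "K \<noteq> {}" "continuous_on K g"
    and P: "\<And>v. P v \<longleftrightarrow> (\<exists>x\<in>K. v = g x)"
  shows "P (LEAST v. P v)" and "P v \<Longrightarrow> (LEAST v. P v) \<le> v"
proof -
  obtain a where a: "a \<in> K" "\<And>x. x \<in> K \<Longrightarrow> g a \<le> g x"
    using continuous_attains_inf[OF assms(1-3)] by blast
  have Least: "(LEAST v. P v) = g a"
    by (rule Least_equality) (use a P in auto)
  show "P (LEAST v. P v)" unfolding Least using a(1) P by blast
  show "(LEAST v. P v) \<le> v" if "P v" unfolding Least using a that P by auto
qed

text \<open>
  Vectors are total functions, so the values outside \<open>I\<close> are pinned to zero in order to get a set
  that is compact in the product topology.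
\<close>

definition supported_box :: "'i set \<Rightarrow> ('i \<Rightarrow> real) set" where
  "supported_box I = {x. (\<forall>i\<in>I. \<bar>x i\<bar> \<le> 1) \<and> (\<forall>i. i \<notin> I \<longrightarrow> x i = 0)}"

lemma compact_supported_box: "compact (supported_box I)"
proof -
  have "supported_box I = (\<Pi>\<^sub>E i\<in>UNIV. if i \<in> I then {-1..1} else {0})"
    unfolding supported_box_def by (auto simp: PiE_iff abs_le_iff split: if_splits)
  moreover have "compactin (product_topology (\<lambda>i. euclidean) UNIV)
                   (\<Pi>\<^sub>E i\<in>UNIV. if i \<in> I then {-1..1::real} else {0})"
    unfolding compactin_PiE by auto
  ultimately show ?thesis
    by (simp add: euclidean_product_topology)
qed

lemma continuous_on_coordinate [continuous_intros]:
  fixes S :: "('i \<Rightarrow> real) set"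
  shows "continuous_on S (\<lambda>x. x i)"
  by (rule continuous_on_subset[OF continuous_on_product_coordinates]) auto

lemma continuous_on_Max_image:
  fixes f :: "'i \<Rightarrow> 'a::topological_space \<Rightarrow> real"
  assumes "finite I" "I \<noteq> {}" "\<And>i. i \<in> I \<Longrightarrow> continuous_on S (f i)"
  shows "continuous_on S (\<lambda>x. Max ((\<lambda>i. f i x) ` I))"
  using assms
proof (induction I rule: finite_ne_induct)
  case (insert i I)
  then show ?case by (simp add: continuous_on_max)
qed simp

lemma continuous_on_prod_list_map [continuous_intros]:
  fixes S :: "('i \<Rightarrow> real) set"
  shows "continuous_on S (\<lambda>x. prod_list (map x js))"
  by (induction js) (auto intro!: continuous_intros)

lemma continuous_on_tensor_apply [continuous_intros]:
  "continuous_on S (\<lambda>x. tensor_apply m I A x i)"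
  unfolding tensor_apply_def by (intro continuous_intros)

section \<open>Dependence of the tensor maps on the vector\<close>

lemma tensor_apply_cong:
  assumes "\<And>i. i \<in> I \<Longrightarrow> x i = y i"
  shows "tensor_apply m I A x i = tensor_apply m I A y i"
  unfolding tensor_apply_def
proof (rule sum.cong)
  fix js assume "js \<in> {js. set js \<subseteq> I \<and> length js = m - 1}"
  then have "map x js = map y js" using assms by auto
  then show "A (i # js) * prod_list (map x js) = A (i # js) * prod_list (map y js)" by (simp only:)
qed simp

lemma T_map_cong:
  assumes "\<And>i. i \<in> I \<Longrightarrow> x i = y i"
  shows "T_map m I A x i = T_map m I A y i"
  using assms by (simp add: T_map_def L2_set_def cong: tensor_apply_cong)

lemma tensor_apply_scale:
  "tensor_apply m I A (\<lambda>j. c * x j) i = c ^ (m - 1) * tensor_apply m I A x i"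
proof -
  have "prod_list (map (\<lambda>j. c * x j) js) = c ^ length js * prod_list (map x js)" for js
    by (induction js) auto
  then show ?thesis
    unfolding tensor_apply_def sum_distrib_left by (intro sum.cong) auto
qed

lemma tensor_apply_zero_extension:
  assumes "finite I" "J \<subseteq> I"
  shows "tensor_apply m I A (\<lambda>j. if j \<in> J then x j else 0) i = tensor_apply m J A x i"
  unfolding tensor_apply_def
proof (rule sum.mono_neutral_cong_right)
  show "finite {js. set js \<subseteq> I \<and> length js = m - 1}"
    using finite_lists_length_eq[OF assms(1)] .
  show "{js. set js \<subseteq> J \<and> length js = m - 1} \<subseteq> {js. set js \<subseteq> I \<and> length js = m - 1}"
    using assms(2) by auto
  show "\<forall>js\<in>{js. set js \<subseteq> I \<and> length js = m - 1} - {js. set js \<subseteq> J \<and> length js = m - 1}.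
          A (i # js) * prod_list (map (\<lambda>j. if j \<in> J then x j else 0) js) = 0"
    by (auto simp: prod_list_zero_iff image_iff)
  fix js assume "js \<in> {js. set js \<subseteq> J \<and> length js = m - 1}"
  then have "map (\<lambda>j. if j \<in> J then x j else 0) js = map x js" by auto
  then show "A (i # js) * prod_list (map (\<lambda>j. if j \<in> J then x j else 0) js)
             = A (i # js) * prod_list (map x js)" by (simp only:)
qed

section \<open>Attainment of the two minima\<close>

lemma least_Z_eigenvalue_attained:
  assumes "finite I" and ex: "Z_eigenvalue m I A \<mu>"
  shows "Z_eigenvalue m I A (least_Z_eigenvalue m I A)"
proof -
  define g where "g x = (\<Sum>i\<in>I. x i * tensor_apply m I A x i)" for x
  define K where "K = supported_box I \<inter> ({x. (\<Sum>i\<in>I. x i * x i) = 1} \<inter>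
                        (\<Inter>i\<in>I. {x. tensor_apply m I A x i = g x * x i}))"
  have g_cont: "continuous_on S g" for S
    unfolding g_def by (intro continuous_intros)
  have "compact K"
    unfolding K_def
    by (intro compact_Int_closed compact_supported_box closed_Int closed_INT ballI
          closed_Collect_eq continuous_intros g_cont)
  have iff: "Z_eigenvalue m I A v \<longleftrightarrow> (\<exists>x\<in>K. v = g x)" for v
  proof
    assume "Z_eigenvalue m I A v"
    then obtain x where x: "(\<Sum>i\<in>I. x i * x i) = 1" "\<forall>i\<in>I. tensor_apply m I A x i = v * x i"
      unfolding Z_eigenvalue_def by blast
    define y where "y i = (if i \<in> I then x i else 0)" for i
    have y: "(\<Sum>i\<in>I. y i * y i) = 1" "\<forall>i\<in>I. tensor_apply m I A y i = v * y i"
      using x tensor_apply_cong[of I x y m A] by (auto simp: y_def cong: sum.cong)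
    \<comment> \<open>Pairing the eigenvector equation with the unit vector itself recovers the eigenvalue.\<close>
    have "g y = (\<Sum>i\<in>I. v * (y i * y i))"
      unfolding g_def using y(2) by (intro sum.cong) auto
    also have "\<dots> = v" using y(1) by (simp add: sum_distrib_left[symmetric])
    finally have v: "v = g y" ..
    have "\<bar>y i\<bar> \<le> 1" if "i \<in> I" for i
    proof -
      have "y i * y i \<le> 1"
        using member_le_sum[of i I "\<lambda>i. y i * y i"] that \<open>finite I\<close> y(1) by auto
      then show ?thesis by (simp add: power2_eq_square flip: abs_square_le_1)
    qed
    then have "y \<in> K"
      unfolding K_def supported_box_def using y v by (auto simp: y_def)
    with v show "\<exists>x\<in>K. v = g x" by blast
  next
    assume "\<exists>x\<in>K. v = g x"
    then show "Z_eigenvalue m I A v"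
      unfolding K_def Z_eigenvalue_def by blast
  qed
  have "K \<noteq> {}" using ex iff by blast
  from Least_image_attained(1)[OF \<open>compact K\<close> this g_cont iff]
  show ?thesis unfolding least_Z_eigenvalue_def .
qed

lemma alpha_T_le:
  assumes "finite I" "I \<noteq> {}" and x: "sup_norm_on I x = 1"
  shows "alpha_T m I A \<le> Max ((\<lambda>i. x i * T_map m I A x i) ` I)"
proof -
  define K where "K = supported_box I \<inter> {x. sup_norm_on I x = 1}"
  define g where "g x = Max ((\<lambda>i. x i * T_map m I A x i) ` I)" for x
  have nz: "\<exists>j\<in>I. y j \<noteq> 0" if "sup_norm_on I y = 1" for y
  proof (rule ccontr)
    assume "\<not> ?thesis"
    then have "(\<lambda>i. \<bar>y i\<bar>) ` I = {0}" using assms(2) by force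
    then show False using that by (simp add: sup_norm_on_def)
  qed
  have "compact K"
    unfolding K_def sup_norm_on_def
    by (intro compact_Int_closed compact_supported_box closed_Collect_eq continuous_on_Max_image
          continuous_intros assms)
  have T: "T_map m I A y i = L2_set y I powi (2 - int m) * tensor_apply m I A y i"
    and L2: "L2_set y I \<noteq> 0" if "y \<in> K" for y i
    using nz[of y] that assms(1) by (auto simp: K_def T_map_def L2_set_eq_0_iff)
  have cont: "continuous_on K (\<lambda>y. y i * (L2_set y I powi (2 - int m) * tensor_apply m I A y i))" for i
    using L2 unfolding L2_set_def by (intro continuous_intros) auto
  have "continuous_on K (\<lambda>y. y i * T_map m I A y i)" for i
    using cont[of i] by (rule continuous_on_eq) (simp add: T)
  then have g_cont: "continuous_on K g"
    unfolding g_def by (intro continuous_on_Max_image assms)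
  have iff: "(\<exists>x. sup_norm_on I x = 1 \<and> v = g x) \<longleftrightarrow> (\<exists>x\<in>K. v = g x)" for v
  proof
    assume "\<exists>x. sup_norm_on I x = 1 \<and> v = g x"
    then obtain x where x: "sup_norm_on I x = 1" "v = g x" by blast
    define y where "y i = (if i \<in> I then x i else 0)" for i
    have "(\<lambda>i. \<bar>y i\<bar>) ` I = (\<lambda>i. \<bar>x i\<bar>) ` I" by (auto simp: y_def)
    then have y: "sup_norm_on I y = 1" using x by (simp add: sup_norm_on_def)
    have "T_map m I A y i = T_map m I A x i" for i by (rule T_map_cong) (simp add: y_def)
    then have "g y = g x" unfolding g_def by (simp add: y_def cong: image_cong)
    moreover have "\<bar>y i\<bar> \<le> 1" if "i \<in> I" for i
    proof -
      have "\<bar>y i\<bar> \<le> sup_norm_on I y"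
        unfolding sup_norm_on_def using assms(1) that by (intro Max_ge) auto
      then show ?thesis using y by simp
    qed
    ultimately show "\<exists>x\<in>K. v = g x"
      using x y by (intro bexI[of _ y]) (auto simp: K_def supported_box_def y_def)
  qed (auto simp: K_def)
  have "K \<noteq> {}" using iff x by blast
  from Least_image_attained(2)[OF \<open>compact K\<close> this g_cont iff, of "g x"] x
  show ?thesis unfolding alpha_T_def g_def by blast
qed

section \<open>Z-eigenvalues of principal sub-tensors\<close>

lemma zero_extension_product:
  assumes "finite I" "J \<subseteq> I" and "\<forall>i\<in>J. tensor_apply m J A x i = \<mu> * x i"
    and y: "y = (\<lambda>i. if i \<in> J then x i else 0)"
  shows "y i * tensor_apply m I A y i = \<mu> * (y i)\<^sup>2"
  using assms(3) tensor_apply_zero_extension[OF assms(1,2), of m A x i]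
  by (auto simp: y power2_eq_square)

text \<open>
  The witness is the zero extension of the eigenvector, rescaled to sup norm one.  The sign of \<open>\<mu>\<close> matters because for \<open>\<mu> < 0\<close> the maximum of
  \<open>\<mu> y\<^sub>i\<^sup>2\<close> would be attained at a coordinate of smallest modulus instead of a largest one.
\<close>

lemma Z_eigenvalue_is_minimax_value:
  assumes "finite I" "J \<subseteq> I" "m \<ge> 1" and P: "P_tensor m I A" and ev: "Z_eigenvalue m J A \<mu>"
  obtains z where "sup_norm_on I z = 1" "Max ((\<lambda>i. z i * T_map m I A z i) ` I) = \<mu>"
proof -
  obtain x where x: "(\<Sum>i\<in>J. x i * x i) = 1" "\<forall>i\<in>J. tensor_apply m J A x i = \<mu> * x i"
    using ev unfolding Z_eigenvalue_def by blast
  define y where "y = (\<lambda>i. if i \<in> J then x i else 0)"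
  have prod: "y i * tensor_apply m I A y i = \<mu> * (y i)\<^sup>2" for i
    using zero_extension_product[OF assms(1,2) x(2) y_def] .
  have sum1: "(\<Sum>i\<in>I. (y i)\<^sup>2) = 1"
  proof -
    have "(\<Sum>i\<in>I. (y i)\<^sup>2) = (\<Sum>i\<in>J. x i * x i)"
      by (rule sum.mono_neutral_cong_right) (use assms in \<open>auto simp: y_def power2_eq_square\<close>)
    then show ?thesis using x by simp
  qed
  obtain j where j: "j \<in> I" "y j \<noteq> 0"
    using sum1 by (metis (mono_tags, lifting) power_zero_numeral sum.neutral zero_neq_one)
  then have ne: "I \<noteq> {}" by auto
  have "Max ((\<lambda>i. \<mu> * (y i)\<^sup>2) ` I) > 0"
    using P j unfolding P_tensor_def prod[symmetric] by blast
  then obtain k where "k \<in> I" "\<mu> * (y k)\<^sup>2 > 0"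
    using assms(1) ne by (auto simp: Max_gr_iff)
  then have pos: "\<mu> > 0"
    by (simp add: zero_less_mult_iff)
  define s where "s = sup_norm_on I y"
  have le_s: "\<bar>y i\<bar> \<le> s" if "i \<in> I" for i
    unfolding s_def sup_norm_on_def using assms(1) that by (intro Max_ge) auto
  have s: "s > 0" using le_s[OF j(1)] j(2) by linarith
  have "s \<in> (\<lambda>i. \<bar>y i\<bar>) ` I"
    unfolding s_def sup_norm_on_def using assms(1) ne by (intro Max_in) auto
  then obtain k where k: "k \<in> I" "\<bar>y k\<bar> = s" by blast
  define z where "z = (\<lambda>i. inverse s * y i)"
  have z_le: "\<bar>z i\<bar> \<le> 1" if "i \<in> I" for i
    using le_s[OF that] s by (simp add: z_def abs_mult field_simps)
  have z_k: "\<bar>z k\<bar> = 1" using k s by (simp add: z_def abs_mult)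
  have "sup_norm_on I z = 1"
    unfolding sup_norm_on_def
    by (rule Max_eqI) (use assms(1) z_le z_k k(1) in \<open>auto simp: rev_image_eqI\<close>)
  moreover have "z i * T_map m I A z i = \<mu> * (z i)\<^sup>2" for i
  proof -
    have nz: "\<not> (\<forall>j\<in>I. z j = 0)" using k(1) z_k by force
    have L2: "L2_set z I = inverse s"
      using s sum1 unfolding z_def L2_set_def
      by (simp add: power_mult_distrib flip: sum_distrib_left)
    \<comment> \<open>Dividing \<open>y\<close> by \<open>s\<close> scales the norm factor by \<open>s\<^bsup>m-2\<^esup>\<close> and the tensor by \<open>s\<^bsup>1-m\<^esup>\<close>.\<close>
    have "inverse s powi (2 - int m) * inverse s ^ (m - 1) = inverse s powi (2 - int m + int (m - 1))"
      using s by (subst power_int_add) (auto simp: power_int_of_nat)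
    also have "2 - int m + int (m - 1) = 1" using assms(3) by simp
    finally have scale: "inverse s powi (2 - int m) * inverse s ^ (m - 1) = inverse s" by simp
    have "T_map m I A z i = inverse s powi (2 - int m) * tensor_apply m I A z i"
      using nz by (simp only: T_map_def L2 if_False)
    also have "\<dots> = inverse s * tensor_apply m I A y i"
      unfolding z_def tensor_apply_scale mult.assoc[symmetric] scale ..
    finally have "T_map m I A z i = inverse s * tensor_apply m I A y i" .
    then have "z i * T_map m I A z i = (inverse s)\<^sup>2 * (y i * tensor_apply m I A y i)"
      by (simp add: z_def power2_eq_square)
    then show ?thesis unfolding prod by (simp add: z_def power_mult_distrib)
  qed
  moreover have "Max ((\<lambda>i. \<mu> * (z i)\<^sup>2) ` I) = \<mu>"
  proof (rule Max_eqI)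
    show "finite ((\<lambda>i. \<mu> * (z i)\<^sup>2) ` I)" using assms(1) by simp
    show "v \<le> \<mu>" if "v \<in> (\<lambda>i. \<mu> * (z i)\<^sup>2) ` I" for v
      using that z_le pos by (auto simp: abs_square_le_1 mult_le_cancel_left1)
    have "(z k)\<^sup>2 = 1" using z_k by (simp add: power2_eq_1_iff abs_if split: if_splits)
    then show "\<mu> \<in> (\<lambda>i. \<mu> * (z i)\<^sup>2) ` I" using k(1) by (auto intro!: image_eqI[of _ _ k])
  qed
  ultimately show thesis using that by simp
qed

lemma Z_eigenvalue_singleton:
  assumes "even m" "m \<ge> 2"
  shows "Z_eigenvalue m {i} A \<mu> \<longleftrightarrow> \<mu> = A (replicate m i)"
proof -
  have "{js. set js \<subseteq> {i} \<and> length js = m - 1} = {replicate (m - 1) i}"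
    by (auto simp: replicate_eqI subset_eq)
  moreover have "i # replicate (m - 1) i = replicate m i"
    using assms by (cases m) auto
  ultimately have app: "tensor_apply m {i} A x i = A (replicate m i) * x i ^ (m - 1)" for x
    by (simp add: tensor_apply_def map_replicate_const prod_list_replicate)
  have "odd (m - 1)" using assms by auto
  then have pow: "t ^ (m - 1) = t" if "t * t = 1" for t :: real
    using that square_eq_1_iff[of t] by auto
  show ?thesis
  proof
    assume "Z_eigenvalue m {i} A \<mu>"
    then obtain x where "x i * x i = 1" "A (replicate m i) * x i ^ (m - 1) = \<mu> * x i"
      unfolding Z_eigenvalue_def app by (auto simp: app)
    then show "\<mu> = A (replicate m i)" using pow[of "x i"] by auto
  next
    assume "\<mu> = A (replicate m i)"
    then show "Z_eigenvalue m {i} A \<mu>"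
      unfolding Z_eigenvalue_def by (intro exI[of _ "\<lambda>_. 1"]) (simp add: app)
  qed
qed

section \<open>The bounds on \<open>delta_Z\<close>\<close>

theorem theorem3p2:
  fixes m n :: nat and A :: "nat tensor"
  assumes "m \<ge> 2" and "even m" and "n \<ge> 1"
    and "P_tensor m {1..n} A"
  shows "alpha_T m {1..n} A \<le> delta_Z m {1..n} A
    \<and> delta_Z m {1..n} A \<le> Min ((\<lambda>i. A (replicate m i)) ` {1..n})"
proof -
  let ?I = "{1..n}"
  define S where
    "S = {least_Z_eigenvalue m J A | J. J \<subseteq> ?I \<and> J \<noteq> {} \<and> (\<exists>\<mu>. Z_eigenvalue m J A \<mu>)}"
  have delta: "delta_Z m ?I A = Min S" unfolding delta_Z_def S_def ..
  have "S \<subseteq> (\<lambda>J. least_Z_eigenvalue m J A) ` Pow ?I" unfolding S_def by auto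
  then have "finite S" by (rule finite_subset) simp
  have diag: "A (replicate m i) \<in> S" if "i \<in> ?I" for i
  proof -
    have "least_Z_eigenvalue m {i} A = A (replicate m i)"
      unfolding least_Z_eigenvalue_def Z_eigenvalue_singleton[OF assms(2,1)]
      by (rule Least_equality) auto
    moreover have "\<exists>\<mu>. Z_eigenvalue m {i} A \<mu>"
      using Z_eigenvalue_singleton[OF assms(2,1), of i A] by blast
    ultimately show ?thesis
      unfolding S_def using that by (intro CollectI exI[of _ "{i}"]) auto
  qed
  have ne: "?I \<noteq> {}" using assms(3) by simp
  then have "S \<noteq> {}" using diag by blast
  then have "Min S \<in> S" using \<open>finite S\<close> by (rule Min_in[rotated])
  then obtain J \<mu> where J: "J \<subseteq> ?I" "Z_eigenvalue m J A \<mu>" "Min S = least_Z_eigenvalue m J A"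
    unfolding S_def by blast
  have "finite J" using J(1) finite_subset by blast
  then have "Z_eigenvalue m J A (Min S)"
    unfolding J(3) using J(2) by (rule least_Z_eigenvalue_attained)
  then obtain z where z: "sup_norm_on ?I z = 1" "Max ((\<lambda>i. z i * T_map m ?I A z i) ` ?I) = Min S"
    using Z_eigenvalue_is_minimax_value[of ?I J m A] J(1) assms(1,4) by auto
  have "alpha_T m ?I A \<le> Min S"
    using alpha_T_le[OF _ ne z(1), of m A] z(2) by simp
  moreover have "Min S \<le> Min ((\<lambda>i. A (replicate m i)) ` ?I)"
    using ne diag \<open>finite S\<close> by (auto intro!: Min.boundedI)
  ultimately show ?thesis unfolding delta ..
qed

end
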